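(* Let $\varphi\in SN$ have the Baire property or be measurable, with $\varphi$ eventually bounded away from $0$ and $1/\varphi$ locally integrable, and let $f:\mathbb{R}\to(0,\infty)$ be measurable and $\varphi$-regularly varying. Then for some $\rho\in\mathbb{R}$ and some $\varphi$-slowly varying function $\tilde f$, $$f(x)=f_\rho(x)\tilde f(x)=\exp\left(\rho\int_1^x\frac{du}{\varphi(u)}\right)\tilde f(x),\qquad\text{where } f_\rho(x):=\exp\left(\rho\int_1^x\frac{du}{\varphi(u)}\right).$$ Any function of this form is $\varphi$-regularly varying with index $\rho$. Consequently $f\sim f_\rho\,\phi$ for some smooth representation $\phi$ of $\tilde f$.
   Context: A function $\varphi:\mathbb{R}\to(0,\infty)$ is self-neglecting, written $\varphi\in SN$, if $\varphi(x+t\varphi(x))/\varphi(x)\to 1$ as $x\to\infty$, locally uniformly in $t\in\mathbb{R}$. "Eventually bounded away from $0$" means there are $K>0$ and $X$ with $\varphi(x)\ge K$ for all $x\ge X$. For $\varphi\in SN$, a function $f:\mathbb{R}\to(0,\infty)$ that has the Baire property or is Lebesgue measurable is $\varphi$-regularly varying if for some function $g$, $f(x+t\varphi(x))/f(x)\to g(t)$ as $x\to\infty$ for every $t\in\mathbb{R}$, where $g$ is non-zero, i.e. $g>0$ on a non-negligible set (negligible means meagre in the Baire case, Lebesgue null in the measurable case). It is $\varphi$-regularly varying with index $\rho$ if $g(t)=e^{\rho t}$ for all $t$, and $\varphi$-slowly varying if $g(t)=1$ for all $t$. For positive functions, $a\sim b$ means $a(x)/b(x)\to1$ as $x\to\infty$.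 A smooth representation of $\tilde f$ is a continuously differentiable function $\phi>0$ with $\tilde f\sim\phi$. *)

theory Defs
  imports "HOL-Analysis.Analysis" "HOL-Library.Landau_Symbols"
begin

definition nowhere_dense :: "'a::topological_space set \<Rightarrow> bool" where
  "nowhere_dense S \<longleftrightarrow> interior (closure S) = {}"

definition meagre :: "'a::topological_space set \<Rightarrow> bool" where
  "meagre S \<longleftrightarrow> (\<exists>N :: nat \<Rightarrow> 'a set. (\<forall>n. nowhere_dense (N n)) \<and> S \<subseteq> (\<Union>n. N n))"

definition baire_property_set :: "'a::topological_space set \<Rightarrow> bool" where
  "baire_property_set S \<longleftrightarrow> (\<exists>U. open U \<and> meagre (sym_diff S U))"

definition baire_property :: "('a::topological_space \<Rightarrow> 'b::topological_space) \<Rightarrow> bool" where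
  "baire_property f \<longleftrightarrow> (\<forall>V. open V \<longrightarrow> baire_property_set (f -` V))"

text \<open>Locally uniform convergence on the real line is uniform convergence on compact sets.\<close>

definition self_neglecting :: "(real \<Rightarrow> real) \<Rightarrow> bool" where
  "self_neglecting \<phi> \<longleftrightarrow> (\<forall>x. \<phi> x > 0) \<and>
     (\<forall>C. compact C \<longrightarrow>
        uniform_limit C (\<lambda>x t. \<phi> (x + t * \<phi> x) / \<phi> x) (\<lambda>t. 1) at_top)"

text \<open>Regular variation with a prescribed limit function \<open>g\<close>. The notion of negligible set
  is tied to the regularity of \<open>f\<close>. Measurability is Lebesgue, not Borel; the measure
  \<open>lebesgue\<close> is complete, so its null sets are exactly the Lebesgue null sets.\<close>

definition beurling_rv_limit :: "(real \<Rightarrow> real) \<Rightarrow> (real \<Rightarrow> real) \<Rightarrow> (real \<Rightarrow> real) \<Rightarrow> bool" where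
  "beurling_rv_limit \<phi> f g \<longleftrightarrow>
     (\<forall>x. f x > 0) \<and>
     (\<forall>t. ((\<lambda>x. f (x + t * \<phi> x) / f x) \<longlongrightarrow> g t) at_top) \<and>
     (baire_property f \<and> \<not> meagre {t. g t > 0} \<or>
      f \<in> borel_measurable lebesgue \<and> {t. g t > 0} \<notin> null_sets lebesgue)"

definition beurling_regularly_varying :: "(real \<Rightarrow> real) \<Rightarrow> (real \<Rightarrow> real) \<Rightarrow> bool" where
  "beurling_regularly_varying \<phi> f \<longleftrightarrow> (\<exists>g. beurling_rv_limit \<phi> f g)"

definition beurling_rv_index :: "(real \<Rightarrow> real) \<Rightarrow> real \<Rightarrow> (real \<Rightarrow> real) \<Rightarrow> bool" where
  "beurling_rv_index \<phi> \<rho> f \<longleftrightarrow> beurling_rv_limit \<phi> f (\<lambda>t. exp (\<rho> * t))"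

definition beurling_slowly_varying :: "(real \<Rightarrow> real) \<Rightarrow> (real \<Rightarrow> real) \<Rightarrow> bool" where
  "beurling_slowly_varying \<phi> f \<longleftrightarrow> beurling_rv_limit \<phi> f (\<lambda>t. 1)"

text \<open>The interval integral is oriented, so this is the intended function also for \<open>x < 1\<close>.\<close>

definition beurling_power :: "(real \<Rightarrow> real) \<Rightarrow> real \<Rightarrow> real \<Rightarrow> real" where
  "beurling_power \<phi> \<rho> x =
     exp (\<rho> * interval_lebesgue_integral lebesgue (ereal 1) (ereal x) (\<lambda>u. 1 / \<phi> u))"

definition smooth_representation :: "(real \<Rightarrow> real) \<Rightarrow> (real \<Rightarrow> real) \<Rightarrow> bool" where
  "smooth_representation h \<psi> \<longleftrightarrow>
     (\<forall>x. \<psi> x > 0) \<and> \<psi> C1_differentiable_on UNIV \<and> h \<sim>[at_top] \<psi>"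

end

theory Submission
  imports Defs
begin

text \<open>The heart of the matter is that \<open>f (x + u \<phi> x) / f x \<rightarrow> 1\<close> whenever \<open>x \<rightarrow> \<infinity>\<close> and \<open>u \<rightarrow> 0\<close>
  jointly; this rests on a Steinhaus-type property shared by Lebesgue measure and Baire category.
  Rebasing at \<open>x + t \<phi> x\<close>, where \<open>\<phi>\<close> has asymptotically the same value, gives convergence to
  \<open>g t\<close> whenever \<open>x \<rightarrow> \<infinity>\<close> and \<open>v \<rightarrow> t\<close>, and then \<open>g (s + t) = g s g t\<close> with \<open>g\<close> positive and
  continuous, so \<open>g t = exp (\<rho> t)\<close>. As \<open>1 / \<phi>\<close> is nearly constant on the interval between \<open>x\<close> and
  \<open>x + t \<phi> x\<close>, the integral of \<open>1 / \<phi>\<close> over it tends to \<open>t\<close>, and division by the power factor leaves a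
  slowly varying \<open>h\<close>. If \<open>\<phi> \<ge> K\<close> near infinity, \<open>ln h\<close> has vanishing oscillation on intervals of
  length \<open>K\<close>, hence differs by \<open>o(1)\<close> from its smooth interpolation on the grid of mesh \<open>K\<close>.\<close>

subsection \<open>Measure and category\<close>

lemma meagre_subset: "meagre T \<Longrightarrow> S \<subseteq> T \<Longrightarrow> meagre S"
  unfolding meagre_def by blast

lemma meagre_UN:
  assumes "\<And>n::nat. meagre (S n)"
  shows "meagre (\<Union>n. S n)"
proof -
  obtain N :: "nat \<Rightarrow> nat \<Rightarrow> 'a set"
    where N: "\<And>n k. nowhere_dense (N n k)" "\<And>n. S n \<subseteq> (\<Union>k. N n k)"
    using assms unfolding meagre_def by metis
  show ?thesis
    unfolding meagre_def
  proof (intro exI conjI allI)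
    show "nowhere_dense (case_prod N (prod_decode m))" for m
      by (simp add: N split_beta)
    show "(\<Union>n. S n) \<subseteq> (\<Union>m. case_prod N (prod_decode m))"
    proof
      fix x assume "x \<in> (\<Union>n. S n)"
      then obtain n k where "x \<in> N n k" using N(2) by blast
      then have "x \<in> case_prod N (prod_decode (prod_encode (n, k)))" by simp
      then show "x \<in> (\<Union>m. case_prod N (prod_decode m))" by (rule UN_I[OF UNIV_I])
    qed
  qed
qed

lemma meagre_nowhere_dense: "nowhere_dense S \<Longrightarrow> meagre S"
  unfolding meagre_def by (intro exI[of _ "\<lambda>_. S"]) auto

lemma meagre_Un:
  assumes "meagre S" "meagre T"
  shows "meagre (S \<union> T)"
proof -
  have "meagre (\<Union>n::nat. if n = 0 then S else T)"
    by (rule meagre_UN) (use assms in auto)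
  then show ?thesis by (rule meagre_subset) (auto split: if_splits)
qed

text \<open>Here \<open>h\<close> is a homeomorphism with inverse \<open>k\<close>. If the preimage
  of a nowhere dense \<open>N\<close> were dense in some open set, pulling that set back along
  \<open>k\<close> would give a nonempty open subset of \<open>closure N\<close>.\<close>

lemma meagre_vimage:
  fixes h :: "'a::topological_space \<Rightarrow> 'b::topological_space"
  assumes cont: "continuous_on UNIV h" "continuous_on UNIV k"
    and inv: "\<And>x. h (k x) = x" "\<And>x. k (h x) = x"
    and "meagre S"
  shows "meagre (h -` S)"
proof -
  have nd: "nowhere_dense (h -` N)" if "nowhere_dense N" for N
  proof -
    let ?W = "interior (closure (h -` N))"
    have "closed (h -` closure N)"
      using cont(1) by (intro closed_vimage) auto
    then have "closure (h -` N) \<subseteq> h -` closure N"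
      by (intro closure_minimal) (auto intro: subsetD[OF closure_subset])
    then have "?W \<subseteq> h -` closure N"
      using interior_subset by (rule order_trans[rotated])
    then have "k -` ?W \<subseteq> closure N"
      using inv(1) by fastforce
    moreover have "open (k -` ?W)"
      using cont(2) by (intro open_vimage) auto
    ultimately have "k -` ?W \<subseteq> interior (closure N)"
      by (intro interior_maximal)
    then have "k -` ?W = {}"
      using that by (simp add: nowhere_dense_def)
    then have "?W = {}"
      using inv(2) by (metis equals0D equals0I vimageI)
    then show ?thesis by (simp add: nowhere_dense_def)
  qed
  obtain N where N: "\<And>n::nat. nowhere_dense (N n)" "S \<subseteq> (\<Union>n. N n)"
    using assms(5) unfolding meagre_def by blast
  have "h -` S \<subseteq> (\<Union>n. h -` N n)"
    using vimage_mono[OF N(2), of h] by (simp only: vimage_UN)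
  moreover have "\<And>n. nowhere_dense (h -` N n)"
    using N(1) by (rule nd)
  ultimately show ?thesis
    unfolding meagre_def by (intro exI[of _ "\<lambda>n. h -` N n"]) simp
qed

text \<open>Baire's theorem: the complements of the closures of countably many nowhere dense sets
  are open and dense, so their intersection meets every nonempty open set.\<close>

lemma open_not_meagre:
  fixes U :: "'a::{real_normed_vector,heine_borel} set"
  assumes "open U" "U \<noteq> {}"
  shows "\<not> meagre U"
proof
  assume "meagre U"
  then obtain N where N: "\<And>n::nat. nowhere_dense (N n)" "U \<subseteq> (\<Union>n. N n)"
    unfolding meagre_def by blast
  let ?G = "range (\<lambda>n. - closure (N n))"
  have "UNIV \<subseteq> closure (\<Inter>?G)"
  proof (rule Baire)
    fix T assume "T \<in> ?G"
    then obtain n where "T = - closure (N n)" by blast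
    then show "openin (top_of_set UNIV) T \<and> UNIV \<subseteq> closure T"
      using N(1)[of n] by (simp add: nowhere_dense_def closure_complement open_Compl)
  qed auto
  then have "U \<inter> \<Inter>?G \<noteq> {}"
    using assms open_Int_closure_eq_empty[of U "\<Inter>?G"] by auto
  then obtain z where "z \<in> U" "\<And>n. z \<notin> closure (N n)" by blast
  then show False
    using N(2) closure_subset by blast
qed

section \<open>The sigma-algebra of sets with the Baire property\<close>

lemma baire_property_set_open: "open S \<Longrightarrow> baire_property_set S"
  unfolding baire_property_set_def
  by (intro exI[of _ S] conjI meagre_nowhere_dense) (simp_all add: nowhere_dense_def)

text \<open>The complement of \<open>U\<close> is closed, and a closed set differs from its interior
  by a closed set with empty interior.\<close>

lemma baire_property_set_Compl:
  assumes "baire_property_set S"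
  shows "baire_property_set (- S)"
proof -
  obtain U where U: "open U" "meagre (sym_diff S U)"
    using assms by (auto simp: baire_property_set_def)
  have "nowhere_dense (- U - interior (- U))"
  proof -
    have "closed (- U - interior (- U))"
      using U(1) by (intro closed_Diff) auto
    moreover have "interior (- U - interior (- U)) = {}"
    proof -
      let ?I = "interior (- U - interior (- U))"
      have "?I \<subseteq> - U" "?I \<inter> interior (- U) = {}"
        using interior_subset[of "- U - interior (- U)"] by auto
      moreover from this(1) have "?I \<subseteq> interior (- U)"
        by (intro interior_maximal) auto
      ultimately show ?thesis by blast
    qed
    ultimately show ?thesis by (simp add: nowhere_dense_def closure_closed)
  qed
  then have "meagre (sym_diff S U \<union> (- U - interior (- U)))"
    using U(2) meagre_Un meagre_nowhere_dense by blast
  moreover have "sym_diff (- S) (interior (- U)) \<subseteq> sym_diff S U \<union> (- U - interior (- U))"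
    using interior_subset[of "- U"] by blast
  ultimately show ?thesis
    unfolding baire_property_set_def by (meson meagre_subset open_interior)
qed

lemma baire_property_set_UN:
  assumes "\<And>n::nat. baire_property_set (S n)"
  shows "baire_property_set (\<Union>n. S n)"
proof -
  obtain U where U: "\<And>n. open (U n)" "\<And>n. meagre (sym_diff (S n) (U n))"
    using assms unfolding baire_property_set_def by metis
  have "meagre (\<Union>n. sym_diff (S n) (U n))"
    using U(2) by (rule meagre_UN)
  then have "meagre (sym_diff (\<Union>n. S n) (\<Union>n. U n))"
    by (rule meagre_subset) blast
  then show ?thesis
    unfolding baire_property_set_def using U(1) by blast
qed

text \<open>The sets with the Baire property form a \<open>\<sigma>\<close>-algebra, so functions with the Baire property
  are exactly the measurable functions for the following (trivial) measure. This makes the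
  library's measurability calculus available in the category case.\<close>

definition baire_space :: "'a::topological_space measure" where
  "baire_space = sigma UNIV {S. baire_property_set S}"

lemma sets_baire_space: "sets baire_space = {S::'a::topological_space set. baire_property_set S}"
proof -
  have "sigma_algebra (UNIV :: 'a set) {S. baire_property_set S}"
    unfolding sigma_algebra_iff2
    by (auto simp: Compl_eq_Diff_UNIV[symmetric] image_subset_iff
        intro: baire_property_set_Compl baire_property_set_UN baire_property_set_open)
  then show ?thesis
    unfolding baire_space_def by (simp add: sigma_algebra.sigma_sets_eq)
qed

lemma space_baire_space [simp]: "space baire_space = UNIV"
  by (simp add: baire_space_def space_measure_of_conv)

lemma baire_property_iff_measurable:
  "baire_property f \<longleftrightarrow> f \<in> borel_measurable baire_space"
proof
  assume "baire_property f"
  then show "f \<in> borel_measurable baire_space"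
    by (intro borel_measurableI) (auto simp: baire_property_def sets_baire_space)
next
  assume f: "f \<in> borel_measurable baire_space"
  show "baire_property f"
    unfolding baire_property_def
  proof (intro allI impI)
    fix V :: "'b set" assume "open V"
    then have "f -` V \<inter> space baire_space \<in> sets baire_space"
      using f by (intro measurable_sets[OF f]) auto
    then show "baire_property_set (f -` V)" by (simp add: sets_baire_space)
  qed
qed

lemma baire_property_set_vimage:
  fixes h :: "'a::topological_space \<Rightarrow> 'b::topological_space"
  assumes "continuous_on UNIV h" "continuous_on UNIV k"
    and "\<And>x. h (k x) = x" "\<And>x. k (h x) = x"
    and "baire_property_set S"
  shows "baire_property_set (h -` S)"
proof -
  obtain U where U: "open U" "meagre (sym_diff S U)"
    using assms(5) by (auto simp: baire_property_set_def)
  have "meagre (h -` sym_diff S U)"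
    using assms(1-4) U(2) by (rule meagre_vimage)
  moreover have "open (h -` U)"
    using assms(1) U(1) by (intro open_vimage) auto
  ultimately show ?thesis
    unfolding baire_property_set_def vimage_Un vimage_Diff by blast
qed

section \<open>The Steinhaus-type property for category and for measure\<close>

text \<open>What Lebesgue measure and Baire category have in common; the last assumption is a
  Steinhaus-type property.\<close>

locale affine_density =
  fixes M :: "real measure" and negl :: "real set \<Rightarrow> bool"
  assumes space_UNIV [simp]: "space M = UNIV"
    and affine_measurable: "\<And>a b. a \<noteq> 0 \<Longrightarrow> (\<lambda>t. a * t + b) \<in> M \<rightarrow>\<^sub>M M"
    and negl_subset: "\<And>S T. negl T \<Longrightarrow> S \<subseteq> T \<Longrightarrow> negl S"
    and negl_UN: "\<And>V. (\<And>n::nat. negl (V n)) \<Longrightarrow> negl (\<Union>n. V n)"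
    and meets_affine_preimage:
      "\<And>V a b. V \<in> sets M \<Longrightarrow> \<not> negl V \<Longrightarrow> a \<longlonglongrightarrow> 1 \<Longrightarrow> b \<longlonglongrightarrow> 0 \<Longrightarrow>
        \<forall>\<^sub>F n in sequentially. \<exists>t\<in>V. a n * t + b n \<in> V"

text \<open>Up to a meagre set, \<open>V\<close> is a nonempty open set \<open>U\<close>. For large
  \<open>n\<close> the affine map keeps a fixed point \<open>p\<close> of \<open>U\<close> inside
  \<open>U\<close>, so \<open>U\<close> meets its own preimage in a nonempty open set. The meagre
  errors of \<open>V\<close> and of its preimage cannot cover that set.\<close>

lemma affine_density_baire: "affine_density baire_space meagre"
proof
  have cont: "continuous_on UNIV (\<lambda>t::real. a * t + b)"
    "continuous_on UNIV (\<lambda>t. (t - b) / a)" if "a \<noteq> 0" for a b :: real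
    using that by (auto intro!: continuous_intros)
  show "(\<lambda>t::real. a * t + b) \<in> baire_space \<rightarrow>\<^sub>M baire_space" if "a \<noteq> 0" for a b :: real
    using baire_property_set_vimage[OF cont[OF that, of b]] that
    by (intro measurableI) (auto simp: sets_baire_space)
  show "\<forall>\<^sub>F n in sequentially. \<exists>t\<in>V. a n * t + b n \<in> V"
    if V: "V \<in> sets baire_space" "\<not> meagre V" and ab: "a \<longlonglongrightarrow> 1" "b \<longlonglongrightarrow> 0"
    for V :: "real set" and a b :: "nat \<Rightarrow> real"
  proof -
    obtain U where U: "open U" "meagre (sym_diff V U)"
      using V(1) by (auto simp: baire_property_set_def sets_baire_space)
    have "U \<noteq> {}"
      using U(2) V(2) by auto
    then obtain p where p: "p \<in> U" by blast
    have "(\<lambda>n. a n * p + b n) \<longlonglongrightarrow> 1 * p + 0"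
      by (intro tendsto_intros ab)
    then have "\<forall>\<^sub>F n in sequentially. a n * p + b n \<in> U"
      using U(1) p by (auto dest: topological_tendstoD)
    moreover have "\<forall>\<^sub>F n in sequentially. a n > 0"
      using ab(1) by (rule order_tendstoD) simp
    ultimately show ?thesis
    proof eventually_elim
      case (elim n)
      let ?h = "\<lambda>t. a n * t + b n"
      have "meagre (?h -` sym_diff V U)"
        using cont[of "a n" "b n"] U(2) elim by (intro meagre_vimage[where k = "\<lambda>t. (t - b n) / a n"]) auto
      then have m: "meagre (sym_diff V U \<union> ?h -` sym_diff V U)"
        using U(2) meagre_Un by blast
      have "open (U \<inter> ?h -` U)"
        using U(1) elim cont(1)[of "a n" "b n"] by (intro open_Int open_vimage) auto
      then have "\<not> meagre (U \<inter> ?h -` U)"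
        using p elim by (intro open_not_meagre) auto
      then have "\<not> U \<inter> ?h -` U \<subseteq> sym_diff V U \<union> ?h -` sym_diff V U"
        using m meagre_subset by blast
      then show ?case by blast
    qed
  qed
qed (auto intro: meagre_subset meagre_UN)

text \<open>Take a compact \<open>C\<close> inside \<open>V\<close> of measure \<open>m > 0\<close>
  and an open \<open>W\<close> around it with excess less than \<open>m / 2\<close>. For large
  \<open>n\<close> the image of \<open>C\<close> lies in \<open>W\<close> and has measure above
  \<open>m / 2\<close>, hence does not fit into \<open>W - C\<close> and must meet
  \<open>C\<close>.\<close>

lemma affine_density_lebesgue: "affine_density lebesgue (\<lambda>S. S \<in> null_sets lebesgue)"
proof
  show "(\<lambda>t::real. a * t + b) \<in> lebesgue \<rightarrow>\<^sub>M lebesgue" if "a \<noteq> 0" for a b :: real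
    using lebesgue_affine_measurable[of "\<lambda>_. a" b] that by (simp add: add.commute)
  show "S \<in> null_sets lebesgue" if "T \<in> null_sets lebesgue" "S \<subseteq> T" for S T :: "real set"
    using that null_sets_completion_subset by blast
  show "\<forall>\<^sub>F n in sequentially. \<exists>t\<in>V. a n * t + b n \<in> V"
    if V: "V \<in> sets lebesgue" "V \<notin> null_sets lebesgue" and ab: "a \<longlonglongrightarrow> 1" "b \<longlonglongrightarrow> 0"
    for V :: "real set" and a b :: "nat \<Rightarrow> real"
  proof -
    \<comment> \<open>Inner regularity: if every compact subset were null, so would be the closed
      inner approximations \<open>F n\<close>, being countable unions of compact pieces. Then
      \<open>V\<close> itself would be null.\<close>
    have "\<exists>C\<subseteq>V. compact C \<and> measure lebesgue C > 0"
    proof (rule ccontr)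
      assume no: "\<not> ?thesis"
      obtain F where F: "\<And>n. closed (F n)" "\<And>n::nat. F n \<subseteq> V"
        "\<And>n. emeasure lebesgue (V - F n) < ennreal (1 / Suc n)"
      proof -
        have "\<exists>F. closed F \<and> F \<subseteq> V \<and> emeasure lebesgue (V - F) < ennreal (1 / Suc n)" for n
          by (rule sets_lebesgue_inner_closed[OF V(1), of "1 / Suc n"]) auto
        then show ?thesis using that by metis
      qed
      have meas: "F n \<in> sets lebesgue" for n
        using F(1) by (simp add: borel_closed sets_completionI_sets)
      have nullc: "F n \<inter> cball 0 (real m) \<in> null_sets lebesgue" for n m
      proof -
        have c: "compact (F n \<inter> cball 0 (real m))"
          using F(1) by (intro closed_Int_compact) auto
        then have "F n \<inter> cball 0 (real m) \<in> lmeasurable"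
          by (rule lmeasurable_compact)
        moreover have "measure lebesgue (F n \<inter> cball 0 (real m)) = 0"
          using no c F(2)[of n] by (metis le_infI1 measure_nonneg order_less_le)
        ultimately show ?thesis
          by (simp add: null_setsI fmeasurableD emeasure_eq_measure2)
      qed
      have nullF: "F n \<in> null_sets lebesgue" for n
      proof -
        have "(\<Union>m. F n \<inter> cball 0 (real m)) \<in> null_sets lebesgue"
          using nullc by (rule null_sets_UN)
        moreover have "(\<Union>m. F n \<inter> cball 0 (real m)) = F n"
          using real_arch_simple by (force simp: dist_norm)
        ultimately show ?thesis by simp
      qed
      have "emeasure lebesgue V \<le> ennreal (1 / Suc n)" for n
        using emeasure_Diff_null_set[OF nullF V(1), of n] F(3)[of n] by simp
      moreover have "(\<lambda>n. ennreal (1 / Suc n)) \<longlonglongrightarrow> ennreal 0"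
        by (intro tendsto_ennrealI LIMSEQ_Suc[OF lim_1_over_n])
      ultimately have "emeasure lebesgue V \<le> 0"
        by (intro LIMSEQ_le_const[where X = "\<lambda>n. ennreal (1 / Suc n)"]) auto
      then show False using V by auto
    qed
    then obtain C where C: "C \<subseteq> V" "compact C" "measure lebesgue C > 0" by blast
    have Cm: "C \<in> lmeasurable" using C(2) by (rule lmeasurable_compact)
    define m where "m = measure lebesgue C"
    obtain W where W: "open W" "C \<subseteq> W" "W - C \<in> lmeasurable"
      "emeasure lebesgue (W - C) < ennreal (m / 2)"
      using sets_lebesgue_outer_open[of C "m / 2"] Cm C(3) by (auto simp: m_def fmeasurableD)
    have WC: "measure lebesgue (W - C) < m / 2"
      using W(3,4) by (simp add: emeasure_eq_measure2 ennreal_less_iff)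
    obtain d where d: "d > 0" "\<And>t y. t \<in> C \<Longrightarrow> dist y t < d \<Longrightarrow> y \<in> W"
    proof (cases "W = UNIV")
      case False
      then show ?thesis
        using separate_compact_closed[OF C(2), of "- W"] W that
        by (metis ComplI closed_Compl disjoint_eq_subset_Compl dist_commute double_compl leD)
    qed (use that[of 1] in auto)
    obtain B where B: "\<And>t. t \<in> C \<Longrightarrow> \<bar>t\<bar> \<le> B"
      using C(2) compact_imp_bounded bounded_real by metis
    have "(\<lambda>n. \<bar>a n - 1\<bar> * B + \<bar>b n\<bar>) \<longlonglongrightarrow> \<bar>1 - 1\<bar> * B + \<bar>0\<bar>"
      by (intro tendsto_intros ab)
    then have "\<forall>\<^sub>F n in sequentially. \<bar>a n - 1\<bar> * B + \<bar>b n\<bar> < d"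
      using d(1) by (intro order_tendstoD(2)) auto
    moreover have "\<forall>\<^sub>F n in sequentially. a n > 1 / 2"
      using ab(1) by (rule order_tendstoD) simp
    ultimately show ?thesis
    proof eventually_elim
      case (elim n)
      let ?D = "(\<lambda>t. a n * t + b n) ` C"
      have D: "?D \<subseteq> W"
      proof safe
        fix t assume t: "t \<in> C"
        have "dist (a n * t + b n) t = \<bar>(a n - 1) * t + b n\<bar>"
          by (simp add: dist_real_def algebra_simps)
        also have "\<dots> \<le> \<bar>a n - 1\<bar> * \<bar>t\<bar> + \<bar>b n\<bar>"
          by (metis abs_mult abs_triangle_ineq)
        also have "\<dots> \<le> \<bar>a n - 1\<bar> * B + \<bar>b n\<bar>"
          using B[OF t] by (intro add_mono mult_left_mono) auto
        finally show "a n * t + b n \<in> W" using d(2)[OF t] elim by simp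
      qed
      have Dm: "?D \<in> lmeasurable"
        by (intro lmeasurable_compact compact_continuous_image continuous_intros C)
      have mD: "measure lebesgue ?D = a n * m"
        using measure_lebesgue_affine[of "a n" "b n" C] elim by (simp add: m_def)
      have "C \<inter> ?D \<noteq> {}"
      proof
        assume disj: "C \<inter> ?D = {}"
        then have "?D \<subseteq> W - C" using D by blast
        then have "measure lebesgue ?D \<le> measure lebesgue (W - C)"
          using Dm W(3) by (intro measure_mono_fmeasurable) (auto simp: fmeasurableD)
        moreover have "a n * m > 1/2 * m"
          using elim C(3) by (intro mult_strict_right_mono) (auto simp: m_def)
        ultimately show False
          using WC mD by simp
      qed
      then show ?case using C(1) by blast
    qed
  qed
qed auto

subsection \<open>Uniform convergence\<close>

lemma self_neglecting_pos: "self_neglecting \<phi> \<Longrightarrow> \<phi> x > 0"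
  by (simp add: self_neglecting_def)

lemma self_neglecting_eventually:
  assumes "self_neglecting \<phi>" "compact C" "e > 0"
  shows "\<forall>\<^sub>F x in at_top. \<forall>t\<in>C. \<bar>\<phi> (x + t * \<phi> x) / \<phi> x - 1\<bar> < e"
proof -
  have "uniform_limit C (\<lambda>x t. \<phi> (x + t * \<phi> x) / \<phi> x) (\<lambda>t. 1) at_top"
    using assms by (simp add: self_neglecting_def)
  from uniform_limitD[OF this \<open>e > 0\<close>] show ?thesis
    by (simp add: dist_real_def)
qed

text \<open>Uniformity on a compact interval lets the multiplier vary with \<open>n\<close>, as long
  as it stays bounded.\<close>

lemma self_neglecting_tendsto:
  assumes "self_neglecting \<phi>" "filterlim x at_top sequentially" "Bseq v"
  shows "(\<lambda>n. \<phi> (x n + v n * \<phi> (x n)) / \<phi> (x n)) \<longlonglongrightarrow> 1"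
proof (rule tendstoI)
  fix e :: real assume "e > 0"
  obtain B where B: "\<And>n. \<bar>v n\<bar> \<le> B"
    using assms(3) by (auto simp: Bseq_def)
  have "\<forall>\<^sub>F n in sequentially. \<forall>t\<in>{-B..B}. \<bar>\<phi> (x n + t * \<phi> (x n)) / \<phi> (x n) - 1\<bar> < e"
    using self_neglecting_eventually[OF assms(1) compact_Icc \<open>e > 0\<close>] assms(2)
    by (rule eventually_compose_filterlim)
  then show "\<forall>\<^sub>F n in sequentially. dist (\<phi> (x n + v n * \<phi> (x n)) / \<phi> (x n)) 1 < e"
  proof eventually_elim
    case (elim n)
    then show ?case using B[of n] by (auto simp: dist_real_def abs_le_iff)
  qed
qed

text \<open>If \<open>\<phi> x \<ge> e x\<close> then the origin is \<open>x + t \<phi> x\<close> with \<open>t = -x / \<phi> x\<close> in a fixed compact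
  interval, so \<open>\<phi> x\<close> is comparable with \<open>\<phi> 0\<close>, which is absurd for large \<open>x\<close>.\<close>

lemma self_neglecting_smallo:
  assumes "self_neglecting \<phi>" "e > 0"
  shows "\<forall>\<^sub>F x in at_top. \<phi> x < e * x"
proof -
  have "\<forall>\<^sub>F x in at_top. \<forall>t\<in>{- (1 / e)..0}. \<bar>\<phi> (x + t * \<phi> x) / \<phi> x - 1\<bar> < 1 / 2"
    using assms(1) by (intro self_neglecting_eventually) auto
  moreover have "\<forall>\<^sub>F x in at_top. x > 2 * \<phi> 0 / e"
    by (rule eventually_gt_at_top)
  ultimately show ?thesis
  proof eventually_elim
    case (elim x)
    have pos: "\<phi> x > 0" "\<phi> 0 > 0"
      using assms(1) by (auto intro: self_neglecting_pos)
    have x: "e * x > 2 * \<phi> 0"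
      using elim(2) assms(2) by (simp add: field_simps)
    then have "x > 0"
      using pos(2) assms(2) by (smt (verit) mult_nonneg_nonpos)
    show ?case
    proof (rule ccontr)
      assume "\<not> \<phi> x < e * x"
      then have "- x / \<phi> x \<in> {- (1 / e)..0}"
        using pos(1) assms(2) \<open>x > 0\<close> by (auto simp: field_simps)
      then have "\<bar>\<phi> (x + (- x / \<phi> x) * \<phi> x) / \<phi> x - 1\<bar> < 1 / 2"
        using elim(1) by blast
      moreover have "x + (- x / \<phi> x) * \<phi> x = 0"
        using pos(1) by simp
      ultimately have "\<bar>\<phi> 0 / \<phi> x - 1\<bar> < 1 / 2"
        by (simp only:)
      then have "\<phi> 0 / \<phi> x > 1 / 2" by arith
      then have "\<phi> x < 2 * \<phi> 0"
        using pos(1) by (simp add: field_simps)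
      then show False
        using x \<open>\<not> \<phi> x < e * x\<close> by simp
    qed
  qed
qed

text \<open>Eventually \<open>\<phi> x < x / (2 * B)\<close>, so a shift by at most
  \<open>B * \<phi> x\<close> moves \<open>x\<close> by at most \<open>x / 2\<close>. This allows
  limits at infinity to be rebased at the shifted points.\<close>

lemma self_neglecting_filterlim_shift:
  assumes "self_neglecting \<phi>" "filterlim x at_top sequentially" "Bseq v"
  shows "filterlim (\<lambda>n. x n + v n * \<phi> (x n)) at_top sequentially"
proof -
  obtain B where B: "B > 0" "\<And>n. \<bar>v n\<bar> \<le> B"
    using assms(3) by (auto simp: Bseq_def)
  have "\<forall>\<^sub>F n in sequentially. \<phi> (x n) < 1 / (2 * B) * x n"
    using self_neglecting_smallo[OF assms(1), of "1 / (2 * B)"] B(1) assms(2)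
    by (intro eventually_compose_filterlim[OF _ assms(2)]) auto
  then have "\<forall>\<^sub>F n in sequentially. x n / 2 \<le> x n + v n * \<phi> (x n)"
  proof eventually_elim
    case (elim n)
    have "\<bar>v n * \<phi> (x n)\<bar> \<le> B * \<phi> (x n)"
      using B(2)[of n] self_neglecting_pos[OF assms(1), of "x n"]
      by (simp add: abs_mult mult_right_mono)
    also have "\<dots> \<le> B * (1 / (2 * B) * x n)"
      using elim B(1) by (intro mult_left_mono) auto
    also have "\<dots> = x n / 2" using B(1) by simp
    finally show ?case by (simp add: abs_le_iff)
  qed
  moreover have "filterlim (\<lambda>n. x n / 2) at_top sequentially"
    using filterlim_tendsto_pos_mult_at_top[OF tendsto_const[of "1/2::real"] _ assms(2)] by simp
  ultimately show ?thesis
    by (rule filterlim_at_top_mono[rotated])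
qed

text \<open>The core of the uniform convergence theorem. With \<open>y = x + u \<phi> x\<close>, the set of those \<open>t\<close>
  for which the logarithms of both \<open>f (x + t \<phi> x) / f x\<close> and \<open>f (y + t \<phi> y) / f y\<close>
  eventually stay in a given interval of length \<open>2 e\<close> is non-negligible for a suitable interval. It
  then contains some \<open>t\<close> together with the \<open>s\<close> for which \<open>y + s \<phi> y = x + t \<phi> x\<close>, as \<open>s\<close> is an
  affine function of \<open>t\<close> close to the identity.\<close>

lemma (in affine_density) ratio_tendsto_1:
  fixes f g \<phi> :: "real \<Rightarrow> real"
  assumes sn: "self_neglecting \<phi>"
    and f [measurable]: "f \<in> borel_measurable M" and pos: "\<And>x. f x > 0"
    and lim: "\<And>t. ((\<lambda>x. f (x + t * \<phi> x) / f x) \<longlongrightarrow> g t) at_top"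
    and nonnegl: "\<not> negl {t. g t > 0}"
    and x: "filterlim x at_top sequentially" and u: "u \<longlonglongrightarrow> 0"
  shows "(\<lambda>n. f (x n + u n * \<phi> (x n)) / f (x n)) \<longlonglongrightarrow> 1"
proof -
  note \<phi>pos = self_neglecting_pos[OF sn]
  have f_nz: "f z \<noteq> 0" for z
    using pos[of z] by simp
  have Bu: "Bseq u"
    using u convergent_imp_Bseq convergentI by blast
  define y where "y n = x n + u n * \<phi> (x n)" for n
  have y: "filterlim y at_top sequentially"
    unfolding y_def using sn x Bu by (rule self_neglecting_filterlim_shift)
  have r: "(\<lambda>n. \<phi> (y n) / \<phi> (x n)) \<longlonglongrightarrow> 1"
    unfolding y_def using sn x Bu by (rule self_neglecting_tendsto)
  \<comment> \<open>Solving \<open>y n + s * \<phi> (y n) = x n + t * \<phi> (x n)\<close> for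
    \<open>s\<close> gives \<open>s = a n * t + b n\<close>.\<close>
  define a where "a n = \<phi> (x n) / \<phi> (y n)" for n
  define b where "b n = - u n * a n" for n
  have a: "a \<longlonglongrightarrow> 1"
    unfolding a_def using tendsto_inverse[OF r] by (simp add: inverse_eq_divide)
  have b: "b \<longlonglongrightarrow> 0"
    unfolding b_def using tendsto_mult[OF tendsto_minus[OF u] a] by simp
  define h where "h z t = ln (f (z + t * \<phi> z) / f z)" for z t
  have h_lim: "(\<lambda>n. h (w n) t) \<longlonglongrightarrow> ln (g t)"
    if "filterlim w at_top sequentially" "g t > 0" for w t
    unfolding h_def using that filterlim_compose[OF lim[of t] that(1)]
    by (intro tendsto_ln) auto
  have h_meas [measurable]: "h z \<in> borel_measurable M" for z
  proof -
    have "(\<lambda>t. \<phi> z * t + z) \<in> M \<rightarrow>\<^sub>M M"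
      using \<phi>pos[of z] by (intro affine_measurable) auto
    from measurable_compose[OF this f] have [measurable]: "(\<lambda>t. f (\<phi> z * t + z)) \<in> borel_measurable M" .
    have "h z = (\<lambda>t. ln (f (\<phi> z * t + z) / f z))"
      by (simp add: fun_eq_iff h_def algebra_simps)
    then show ?thesis by simp
  qed
  have "(\<lambda>n. ln (f (y n) / f (x n))) \<longlonglongrightarrow> 0"
  proof (rule tendstoI)
    fix e' :: real assume "e' > 0"
    \<comment> \<open>Two logarithms in a common interval of length \<open>2 * e\<close> differ by
      at most \<open>2 * e\<close>, which is below \<open>e'\<close>.\<close>
    define e where "e = e' / 3"
    have e: "e > 0" using \<open>e' > 0\<close> by (simp add: e_def)
    \<comment> \<open>There are only countably many pairs \<open>(N, j)\<close>, so if these sets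
      cover the points where \<open>g\<close> is positive, one of them is not negligible.\<close>
    define V where "V = (\<lambda>(N, j). {t. \<forall>n\<ge>N. h (x n) t \<in> {of_int j * e..(of_int j + 2) * e} \<and>
      h (y n) t \<in> {of_int j * e..(of_int j + 2) * e}})"
    have V_meas: "V p \<in> sets M" for p
    proof -
      obtain N j where p: "p = (N, j)" by (cases p)
      have "{t \<in> space M. \<forall>n\<ge>N. h (x n) t \<in> {of_int j * e..(of_int j + 2) * e} \<and>
          h (y n) t \<in> {of_int j * e..(of_int j + 2) * e}} \<in> sets M"
        by measurable
      then show ?thesis by (simp add: V_def p)
    qed
    have "{t. g t > 0} \<subseteq> (\<Union>k. V (from_nat k))"
    proof
      fix t assume "t \<in> {t. g t > 0}"
      then have gt: "g t > 0" by simp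
      \<comment> \<open>The intervals overlap, and this choice puts \<open>ln (g t)\<close> strictly
        inside one of them, so that convergence traps both logarithms there.\<close>
      define j where "j = \<lceil>ln (g t) / e\<rceil> - 1"
      have "of_int j < ln (g t) / e" "ln (g t) / e < of_int j + 2"
        unfolding j_def by linarith+
      then have "of_int j * e < ln (g t)" "ln (g t) < (of_int j + 2) * e"
        using e by (auto simp: field_simps)
      then have "\<forall>\<^sub>F n in sequentially. of_int j * e < h (x n) t \<and> h (x n) t < (of_int j + 2) * e \<and>
          of_int j * e < h (y n) t \<and> h (y n) t < (of_int j + 2) * e"
        by (intro eventually_conj order_tendstoD[OF h_lim[OF x gt]] order_tendstoD[OF h_lim[OF y gt]])
      then obtain N where "\<And>n. n \<ge> N \<Longrightarrow> of_int j * e < h (x n) t \<and> h (x n) t < (of_int j + 2) * e \<and>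
          of_int j * e < h (y n) t \<and> h (y n) t < (of_int j + 2) * e"
        unfolding eventually_sequentially by blast
      then have "t \<in> V (N, j)"
        unfolding V_def by (auto intro!: less_imp_le)
      then have "t \<in> V (from_nat (to_nat (N, j)))" by simp
      then show "t \<in> (\<Union>k. V (from_nat k))" by (rule UN_I[OF UNIV_I])
    qed
    then have "\<not> negl (\<Union>k. V (from_nat k))"
      using nonnegl negl_subset by blast
    then obtain k where "\<not> negl (V (from_nat k))"
      using negl_UN[of "\<lambda>k. V (from_nat k)"] by blast
    then obtain p where p: "\<not> negl (V p)" by blast
    obtain N j where Nj: "p = (N, j)" by (cases p)
    have "\<forall>\<^sub>F n in sequentially. \<exists>t\<in>V p. a n * t + b n \<in> V p"
      using V_meas p a b by (rule meets_affine_preimage)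
    moreover have "\<forall>\<^sub>F n in sequentially. n \<ge> N" by (rule eventually_ge_at_top)
    ultimately show "\<forall>\<^sub>F n in sequentially. dist (ln (f (y n) / f (x n))) 0 < e'"
    proof eventually_elim
      case (elim n)
      then obtain t where t: "t \<in> V p" "a n * t + b n \<in> V p" by blast
      define s where "s = a n * t + b n"
      have "s * \<phi> (y n) = (t - u n) * \<phi> (x n)"
        using \<phi>pos[of "y n"] by (simp add: s_def b_def a_def field_simps)
      then have "y n + s * \<phi> (y n) = x n + t * \<phi> (x n)"
        by (simp add: y_def algebra_simps)
      then have "ln (f (y n) / f (x n)) = h (x n) t - h (y n) s"
        by (simp add: h_def ln_div f_nz)
      moreover have "h (x n) t \<in> {of_int j * e..(of_int j + 2) * e}"
        "h (y n) s \<in> {of_int j * e..(of_int j + 2) * e}"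
        using t elim(2) by (auto simp: V_def Nj s_def)
      ultimately have "\<bar>ln (f (y n) / f (x n))\<bar> \<le> 2 * e"
        by (auto simp: algebra_simps abs_le_iff)
      then show ?case using e by (simp add: e_def)
    qed
  qed
  from tendsto_exp[OF this] show ?thesis
    by (simp add: pos y_def)
qed

lemma beurling_rv_limit_ratio_tendsto_1:
  assumes "self_neglecting \<phi>" "beurling_rv_limit \<phi> f g"
    and "filterlim x at_top sequentially" "u \<longlonglongrightarrow> 0"
  shows "(\<lambda>n. f (x n + u n * \<phi> (x n)) / f (x n)) \<longlonglongrightarrow> 1"
proof -
  have "\<And>x. f x > 0" "\<And>t. ((\<lambda>x. f (x + t * \<phi> x) / f x) \<longlongrightarrow> g t) at_top"
    using assms(2) by (auto simp: beurling_rv_limit_def)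
  moreover have "baire_property f \<and> \<not> meagre {t. g t > 0} \<or>
      f \<in> borel_measurable lebesgue \<and> {t. g t > 0} \<notin> null_sets lebesgue"
    using assms(2) by (auto simp: beurling_rv_limit_def)
  ultimately show ?thesis
    using affine_density.ratio_tendsto_1[OF affine_density_baire assms(1), of f g]
      affine_density.ratio_tendsto_1[OF affine_density_lebesgue assms(1), of f g] assms(3,4)
    unfolding baire_property_iff_measurable by blast
qed

section \<open>The limit function and its functional equation\<close>

context
  fixes \<phi> f g :: "real \<Rightarrow> real"
  assumes sn: "self_neglecting \<phi>" and rv: "beurling_rv_limit \<phi> f g"
begin

private lemma pos: "f x > 0" and limit: "((\<lambda>x. f (x + t * \<phi> x) / f x) \<longlongrightarrow> g t) at_top"
  using rv by (auto simp: beurling_rv_limit_def)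

lemma beurling_rv_limit_seq:
  assumes x: "filterlim x at_top sequentially" and v: "v \<longlonglongrightarrow> t"
  shows "(\<lambda>n. f (x n + v n * \<phi> (x n)) / f (x n)) \<longlonglongrightarrow> g t"
proof -
  note \<phi>pos = self_neglecting_pos[OF sn]
  define y where "y n = x n + t * \<phi> (x n)" for n
  have y: "filterlim y at_top sequentially"
    unfolding y_def using sn x by (rule self_neglecting_filterlim_shift) simp
  have r: "(\<lambda>n. \<phi> (y n) / \<phi> (x n)) \<longlonglongrightarrow> 1"
    unfolding y_def using sn x by (rule self_neglecting_tendsto) simp
  \<comment> \<open>Chosen so that the point \<open>x n + v n * \<phi> (x n)\<close>, seen from the
    base point \<open>y n\<close>, has a multiplier tending to 0.\<close>
  define w where "w n = (v n - t) / (\<phi> (y n) / \<phi> (x n))" for n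
  have "w \<longlonglongrightarrow> (t - t) / 1"
    unfolding w_def by (intro tendsto_intros v r) simp
  then have "(\<lambda>n. f (y n + w n * \<phi> (y n)) / f (y n)) \<longlonglongrightarrow> 1"
    by (intro beurling_rv_limit_ratio_tendsto_1[OF sn rv y]) simp
  moreover have "y n + w n * \<phi> (y n) = x n + v n * \<phi> (x n)" for n
    using \<phi>pos[of "x n"] \<phi>pos[of "y n"] by (simp add: w_def y_def field_simps)
  moreover have "(\<lambda>n. f (y n) / f (x n)) \<longlonglongrightarrow> g t"
    unfolding y_def using limit x by (rule filterlim_compose)
  ultimately have "(\<lambda>n. f (x n + v n * \<phi> (x n)) / f (y n) * (f (y n) / f (x n))) \<longlonglongrightarrow> 1 * g t"
    by (intro tendsto_mult) auto
  then show ?thesis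
    using pos by (simp add: less_imp_neq[THEN not_sym])
qed

lemma beurling_rv_limit_add: "g (s + t) = g s * g t"
proof -
  note \<phi>pos = self_neglecting_pos[OF sn]
  define x where "x = (\<lambda>n. real n)"
  have x: "filterlim x at_top sequentially"
    unfolding x_def by (rule filterlim_real_sequentially)
  define y where "y n = x n + s * \<phi> (x n)" for n
  have y: "filterlim y at_top sequentially"
    unfolding y_def using sn x by (rule self_neglecting_filterlim_shift) simp
  have r: "(\<lambda>n. \<phi> (y n) / \<phi> (x n)) \<longlonglongrightarrow> 1"
    unfolding y_def using sn x by (rule self_neglecting_tendsto) simp
  \<comment> \<open>The multiplier that leads from \<open>y n\<close> to
    \<open>x n + (s + t) * \<phi> (x n)\<close>; it tends to \<open>t\<close>.\<close>
  define w where "w n = t / (\<phi> (y n) / \<phi> (x n))" for n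
  have "w \<longlonglongrightarrow> t / 1"
    unfolding w_def by (intro tendsto_intros r) simp
  then have "(\<lambda>n. f (y n + w n * \<phi> (y n)) / f (y n)) \<longlonglongrightarrow> g t"
    by (intro beurling_rv_limit_seq y) simp
  moreover have "y n + w n * \<phi> (y n) = x n + (s + t) * \<phi> (x n)" for n
    using \<phi>pos[of "x n"] \<phi>pos[of "y n"] by (simp add: w_def y_def field_simps)
  moreover have "(\<lambda>n. f (y n) / f (x n)) \<longlonglongrightarrow> g s"
    unfolding y_def using limit x by (rule filterlim_compose)
  ultimately have "(\<lambda>n. (f (y n) / f (x n)) * (f (x n + (s + t) * \<phi> (x n)) / f (y n))) \<longlonglongrightarrow> g s * g t"
    by (intro tendsto_mult) auto
  then have "(\<lambda>n. f (x n + (s + t) * \<phi> (x n)) / f (x n)) \<longlonglongrightarrow> g s * g t"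
    using pos by (simp add: less_imp_neq[THEN not_sym])
  moreover have "(\<lambda>n. f (x n + (s + t) * \<phi> (x n)) / f (x n)) \<longlonglongrightarrow> g (s + t)"
    using limit x by (rule filterlim_compose)
  ultimately show ?thesis by (rule LIMSEQ_unique[rotated])
qed

text \<open>By multiplicativity a single zero of \<open>g\<close> would make \<open>g\<close> vanish
  everywhere, but a non-negligible set is nonempty.\<close>

lemma beurling_rv_limit_pos: "g t > 0"
proof -
  have nonneg: "g s \<ge> 0" for s
    using limit[of s] by (rule tendsto_lowerbound) (auto simp: pos less_imp_le)
  have "{s. g s > 0} \<noteq> {}"
  proof
    assume "{s. g s > 0} = {}"
    then have "meagre {s. g s > 0} \<and> {s. g s > 0} \<in> null_sets lebesgue"
      by (simp add: meagre_nowhere_dense nowhere_dense_def)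
    then show False
      using rv by (auto simp: beurling_rv_limit_def)
  qed
  then obtain s where "g s > 0" by blast
  moreover have "g s = g t * g (s - t)"
    using beurling_rv_limit_add[of t "s - t"] by simp
  ultimately show ?thesis
    using nonneg[of t] by (metis less_eq_real_def mult_zero_left)
qed

text \<open>A diagonal choice: \<open>x n\<close> is taken so large that the ratio at
  \<open>v n\<close> is within \<open>1 / Suc n\<close> of \<open>g (v n)\<close>. Along this
  sequence the joint convergence gives the limit \<open>g 0\<close>.\<close>

lemma beurling_rv_limit_isCont_0: "isCont g 0"
proof (rule continuous_at_sequentiallyI)
  fix v :: "nat \<Rightarrow> real" assume v: "v \<longlonglongrightarrow> 0"
  have "\<exists>x\<ge>real n. \<bar>f (x + v n * \<phi> x) / f x - g (v n)\<bar> < 1 / Suc n" for n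
  proof -
    have "\<forall>\<^sub>F x in at_top. \<bar>f (x + v n * \<phi> x) / f x - g (v n)\<bar> < 1 / Suc n"
      using tendstoD[OF limit[of "v n"], of "1 / Suc n"] by (simp add: dist_real_def)
    then have "\<forall>\<^sub>F x in at_top. x \<ge> real n \<and> \<bar>f (x + v n * \<phi> x) / f x - g (v n)\<bar> < 1 / Suc n"
      by (intro eventually_conj eventually_ge_at_top)
    then show ?thesis
      using eventually_happens'[OF trivial_limit_at_top_linorder] by blast
  qed
  then obtain x where x: "\<And>n. x n \<ge> real n"
    and xv: "\<And>n. \<bar>f (x n + v n * \<phi> (x n)) / f (x n) - g (v n)\<bar> < 1 / Suc n"
    by metis
  have "filterlim x at_top sequentially"
    using filterlim_at_top_mono[OF filterlim_real_sequentially] x by simp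
  then have "(\<lambda>n. f (x n + v n * \<phi> (x n)) / f (x n)) \<longlonglongrightarrow> g 0"
    using v by (rule beurling_rv_limit_seq)
  moreover have "(\<lambda>n. f (x n + v n * \<phi> (x n)) / f (x n) - g (v n)) \<longlonglongrightarrow> 0"
    using LIMSEQ_Suc[OF lim_1_over_n] by (rule Lim_null_comparison[rotated]) (use less_imp_le[OF xv] in auto)
  ultimately have "(\<lambda>n. f (x n + v n * \<phi> (x n)) / f (x n) -
      (f (x n + v n * \<phi> (x n)) / f (x n) - g (v n))) \<longlonglongrightarrow> g 0 - 0"
    by (rule tendsto_diff)
  then show "(\<lambda>n. g (v n)) \<longlonglongrightarrow> g 0" by simp
qed

text \<open>If uniformity failed, compactness would give bad multipliers converging to some
  \<open>l\<close> in \<open>C\<close>. Along them both the ratio and \<open>g\<close> tend to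
  \<open>g l\<close>, a contradiction.\<close>

lemma beurling_rv_limit_uniform:
  assumes "e > 0" and C: "compact C" and g: "continuous_on C g"
  shows "\<forall>\<^sub>F x in at_top. \<forall>t\<in>C. \<bar>f (x + t * \<phi> x) / f x - g t\<bar> < e"
proof (rule ccontr)
  let ?P = "\<lambda>x t. \<bar>f (x + t * \<phi> x) / f x - g t\<bar> < e"
  assume "\<not> ?thesis"
  then have "\<exists>x\<ge>real n. \<exists>t\<in>C. \<not> ?P x t" for n
    unfolding eventually_at_top_linorder by blast
  then obtain x t where xt: "\<And>n. x n \<ge> real n" "\<And>n. t n \<in> C" "\<And>n. \<not> ?P (x n) (t n)"
    by metis
  obtain l r where l: "l \<in> C" and r: "strict_mono r" "(t \<circ> r) \<longlonglongrightarrow> l"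
    using C xt(2) unfolding compact_def by metis
  have "filterlim x at_top sequentially"
    using filterlim_at_top_mono[OF filterlim_real_sequentially] xt(1) by simp
  then have "filterlim (x \<circ> r) at_top sequentially"
    using filterlim_subseq[OF r(1)] by (simp add: filterlim_compose comp_def)
  from beurling_rv_limit_seq[OF this r(2)]
  have "(\<lambda>n. f (x (r n) + t (r n) * \<phi> (x (r n))) / f (x (r n))) \<longlonglongrightarrow> g l"
    by simp
  moreover have "(\<lambda>n. g (t (r n))) \<longlonglongrightarrow> g l"
    using continuous_on_tendsto_compose[OF g r(2) l] xt(2) by simp
  ultimately have "(\<lambda>n. f (x (r n) + t (r n) * \<phi> (x (r n))) / f (x (r n)) - g (t (r n))) \<longlonglongrightarrow> g l - g l"
    by (rule tendsto_diff)
  then have "\<forall>\<^sub>F n in sequentially. dist (f (x (r n) + t (r n) * \<phi> (x (r n))) / f (x (r n)) - g (t (r n))) 0 < e"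
    using \<open>e > 0\<close> by (intro tendstoD) auto
  then obtain n where "?P (x (r n)) (t (r n))"
    using eventually_happens'[OF sequentially_bot] by (auto simp: dist_real_def)
  then show False using xt(3) by blast
qed

end

text \<open>The additive function \<open>k\<close> vanishing at \<open>1\<close> is periodic, hence bounded as it is
  continuous at \<open>0\<close>; as \<open>k (n t) = n k t\<close>, it vanishes.\<close>

lemma additive_isCont_imp_linear:
  fixes k :: "real \<Rightarrow> real"
  assumes add: "\<And>s t. k (s + t) = k s + k t" and cont: "isCont k 0"
  shows "k t = t * k 1"
proof -
  define h where "h t = k t - t * k 1" for t
  have h_add: "h (s + t) = h s + h t" for s t
    by (simp add: h_def add algebra_simps)
  have h0: "h 0 = 0" using h_add[of 0 0] by simp
  have h_nat: "h (real n * t) = real n * h t" for n t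
    by (induction n) (simp_all add: h0 h_add ring_distribs)
  have h_minus: "h (- t) = - h t" for t
    using h_add[of t "- t"] h0 by simp
  have "h 1 = 0" by (simp add: h_def)
  then have h_int: "h (of_int i) = 0" for i
    using h_nat[of "nat \<bar>i\<bar>" 1] h_minus[of "of_int i"] by (cases "i \<ge> 0") auto
  have "isCont h 0"
    unfolding h_def by (intro continuous_intros cont)
  then obtain d where d: "d > 0" "\<And>t. \<bar>t\<bar> < d \<Longrightarrow> \<bar>h t\<bar> < 1"
    unfolding continuous_at_eps_delta using h0
    by (metis diff_zero dist_real_def zero_less_one)
  \<comment> \<open>As \<open>1 / m < d\<close>, dividing a fractional part by \<open>m\<close>
    lands where \<open>h\<close> is below 1 in absolute value; additivity then bounds
    \<open>h\<close> by \<open>m\<close> on a full period.\<close>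
  obtain m where m: "1 / d < real m" using reals_Archimedean2 by blast
  have m_pos: "real m > 0" using m d(1) by (smt (verit) divide_pos_pos)
  have bound: "\<bar>h t\<bar> \<le> real m" for t
  proof -
    let ?s = "frac t"
    have "\<bar>?s / real m\<bar> < 1 / real m"
      using m_pos frac_lt_1[of t] frac_ge_0[of t] by (simp add: divide_strict_right_mono)
    also have "\<dots> < d" using m d(1) m_pos by (simp add: field_simps)
    finally have "\<bar>h (?s / real m)\<bar> < 1" by (rule d(2))
    moreover have "h ?s = real m * h (?s / real m)"
      using h_nat[of m "?s / real m"] m_pos by simp
    moreover have "h t = h ?s"
      using h_add[of "of_int \<lfloor>t\<rfloor>" ?s] h_int by (simp add: frac_def)
    ultimately show ?thesis
      using m_pos by (simp add: abs_mult mult_left_le)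
  qed
  have "h t = 0"
  proof (rule ccontr)
    assume "h t \<noteq> 0"
    then obtain n where n: "real m / \<bar>h t\<bar> < real n" using reals_Archimedean2 by blast
    then have "real m < real n * \<bar>h t\<bar>"
      using \<open>h t \<noteq> 0\<close> by (simp add: field_simps)
    then show False
      using bound[of "real n * t"] by (simp add: h_nat abs_mult)
  qed
  then show ?thesis by (simp add: h_def)
qed

text \<open>The logarithm of \<open>g\<close> is additive and continuous at 0, hence linear; the
  index is \<open>ln (g 1)\<close>.\<close>

lemma beurling_rv_limit_exp:
  assumes sn: "self_neglecting \<phi>" and rv: "beurling_rv_limit \<phi> f g"
  obtains \<rho> where "g = (\<lambda>t. exp (\<rho> * t))"
proof
  note pos = beurling_rv_limit_pos[OF sn rv]
  have ne: "g t \<noteq> 0" for t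
    using pos[of t] by simp
  have "isCont (\<lambda>t. ln (g t)) 0"
    using pos[of 0] by (intro isCont_ln' beurling_rv_limit_isCont_0[OF sn rv]) auto
  then have "ln (g t) = t * ln (g 1)" for t
    by (rule additive_isCont_imp_linear[rotated]) (simp add: beurling_rv_limit_add[OF sn rv] ln_mult ne pos)
  then have "exp (t * ln (g 1)) = g t" for t
    using pos[of t] by (metis exp_ln)
  then show "g = (\<lambda>t. exp (ln (g 1) * t))"
    by (simp add: fun_eq_iff mult.commute)
qed

subsection \<open>The power factor\<close>

text \<open>Passes from the oriented Lebesgue integral, taken over an open interval, to the gauge
  integral over the closed one.\<close>

lemma interval_lebesgue_integral_lebesgue_Icc:
  fixes w :: "real \<Rightarrow> real"
  assumes "\<And>a b. w absolutely_integrable_on {a..b}"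
  shows "interval_lebesgue_integral lebesgue (ereal a) (ereal b) w =
    (if a \<le> b then integral {a..b} w else - integral {b..a} w)"
proof -
  have "w absolutely_integrable_on {c<..<d}" for c d
    using assms[of c d] by (rule set_integrable_subset) auto
  then show ?thesis
    by (simp add: interval_lebesgue_integral_def set_lebesgue_integral_eq_integral integral_open_interval_real)
qed

lemma interval_lebesgue_integral_lebesgue_diff:
  fixes w :: "real \<Rightarrow> real"
  assumes w: "\<And>a b. w absolutely_integrable_on {a..b}" and "a \<le> b"
  shows "interval_lebesgue_integral lebesgue (ereal c) (ereal b) w -
    interval_lebesgue_integral lebesgue (ereal c) (ereal a) w = integral {a..b} w"
proof -
  have int: "w integrable_on {p..q}" for p q
    using w by (rule set_lebesgue_integral_eq_integral)
  have split: "integral {p..q} w + integral {q..r} w = integral {p..r} w" if "p \<le> q" "q \<le> r" for p q r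
    using that int by (intro Henstock_Kurzweil_Integration.integral_combine)
  \<comment> \<open>The base point \<open>c\<close> may lie to the left of \<open>a\<close>, between
    \<open>a\<close> and \<open>b\<close>, or to the right of \<open>b\<close>.\<close>
  show ?thesis
    using \<open>a \<le> b\<close> split[of c a b] split[of a c b] split[of a b c]
    by (auto simp: interval_lebesgue_integral_lebesgue_Icc[OF w])
qed

context
  fixes \<phi> :: "real \<Rightarrow> real"
  assumes sn: "self_neglecting \<phi>"
    and int: "\<And>a b. (\<lambda>u. 1 / \<phi> u) absolutely_integrable_on {a..b}"
begin

private definition F :: "real \<Rightarrow> real"
  where "F x = interval_lebesgue_integral lebesgue (ereal 1) (ereal x) (\<lambda>u. 1 / \<phi> u)"

private lemma F_diff: "a \<le> b \<Longrightarrow> F b - F a = integral {a..b} (\<lambda>u. 1 / \<phi> u)"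
  unfolding F_def using int by (rule interval_lebesgue_integral_lebesgue_diff)

private lemma integrable: "(\<lambda>u. 1 / \<phi> u) integrable_on {a..b}"
  using int by (rule set_lebesgue_integral_eq_integral)

private lemma isCont_F: "isCont F x"
proof -
  have "continuous_on {x - 1..x + 1} (\<lambda>y. F (x - 1) + integral {x - 1..y} (\<lambda>u. 1 / \<phi> u))"
    by (intro continuous_intros indefinite_integral_continuous_1 integrable)
  moreover have "F (x - 1) + integral {x - 1..y} (\<lambda>u. 1 / \<phi> u) = F y" if "y \<in> {x - 1..x + 1}" for y
    using F_diff[of "x - 1" y] that by simp
  ultimately have "continuous_on {x - 1..x + 1} F"
    by (rule continuous_on_eq)
  then show ?thesis
    by (rule continuous_on_interior) simp
qed

private lemma F_bound:
  assumes "a \<le> b" and c: "\<And>u. u \<in> {a..b} \<Longrightarrow> \<bar>1 / \<phi> u - c\<bar> \<le> d"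
  shows "\<bar>F b - F a - (b - a) * c\<bar> \<le> (b - a) * d"
proof -
  have "F b - F a - (b - a) * c = integral {a..b} (\<lambda>u. 1 / \<phi> u - c)"
    using assms(1) by (simp add: F_diff integral_diff[OF integrable integrable_const_ivl])
  moreover have "norm (integral {a..b} (\<lambda>u. 1 / \<phi> u - c)) \<le> integral {a..b} (\<lambda>u. d)"
    using c by (intro integral_norm_bound_integral integrable_diff integrable integrable_const_ivl) auto
  ultimately show ?thesis using assms(1) by simp
qed

text \<open>On the interval between \<open>x\<close> and \<open>x + t * \<phi> x\<close> the
  integrand is within \<open>d / \<phi> x\<close> of \<open>1 / \<phi> x\<close>. The length is
  \<open>\<bar>t\<bar> * \<phi> x\<close>, so the total error is at most
  \<open>\<bar>t\<bar> * d\<close>.\<close>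

private lemma F_shift_tendsto: "((\<lambda>x. F (x + t * \<phi> x) - F x) \<longlongrightarrow> t) at_top"
proof (rule tendstoI)
  fix e :: real assume e: "e > 0"
  define d where "d = e / (\<bar>t\<bar> + 1)"
  have d: "d > 0" "\<bar>t\<bar> * d < e"
    using e by (auto simp: d_def field_simps)
  \<comment> \<open>A ratio \<open>r\<close> within \<open>d / (1 + d)\<close> of 1 exceeds
    \<open>1 / (1 + d)\<close>, so its reciprocal is within \<open>d\<close> of 1.\<close>
  have "\<forall>\<^sub>F x in at_top. \<forall>s\<in>{-\<bar>t\<bar>..\<bar>t\<bar>}. \<bar>\<phi> (x + s * \<phi> x) / \<phi> x - 1\<bar> < d / (1 + d)"
    using d by (intro self_neglecting_eventually sn) auto
  then show "\<forall>\<^sub>F x in at_top. dist (F (x + t * \<phi> x) - F x) t < e"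
  proof eventually_elim
    case (elim x)
    note pos = self_neglecting_pos[OF sn]
    have near: "\<bar>1 / \<phi> u - 1 / \<phi> x\<bar> \<le> d / \<phi> x" if u: "\<bar>u - x\<bar> \<le> \<bar>t\<bar> * \<phi> x" for u
    proof -
      define s where "s = (u - x) / \<phi> x"
      define r where "r = \<phi> u / \<phi> x"
      have "\<bar>s\<bar> \<le> \<bar>t\<bar>"
        using u pos[of x] by (simp add: s_def pos_divide_le_eq flip: abs_div_pos)
      moreover have "x + s * \<phi> x = u"
        using pos[of x] by (simp add: s_def)
      ultimately have r: "\<bar>r - 1\<bar> < d / (1 + d)"
        using elim by (auto simp: r_def abs_le_iff)
      have r_pos: "r > 0" using pos by (simp add: r_def)
      have "1 - d / (1 + d) = 1 / (1 + d)" using d by (simp add: field_simps)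
      then have r1: "1 / (1 + d) < r" using r by linarith
      have "\<bar>r - 1\<bar> \<le> d * r"
      proof -
        have "d / (1 + d) \<le> d * r"
          using mult_strict_left_mono[OF r1 d(1)] by simp
        then show ?thesis using r by linarith
      qed
      then have "\<bar>1 - r\<bar> / r \<le> d"
        using r_pos by (simp add: pos_divide_le_eq abs_minus_commute)
      moreover have "1 / \<phi> u - 1 / \<phi> x = (1 - r) / r / \<phi> x"
        using pos[of x] pos[of u] by (simp add: r_def field_simps)
      then have "\<bar>1 / \<phi> u - 1 / \<phi> x\<bar> = \<bar>1 - r\<bar> / r / \<phi> x"
        using pos[of x] r_pos by (simp only: abs_divide abs_of_pos)
      ultimately show ?thesis
        using pos[of x] by (simp add: divide_right_mono del: divide_divide_eq_left)
    qed
    have px: "\<phi> x > 0" by (rule pos)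
    have "\<bar>F (x + t * \<phi> x) - F x - t\<bar> \<le> \<bar>t\<bar> * d"
    proof (cases "t \<ge> 0")
      case True
      then have "\<bar>F (x + t * \<phi> x) - F x - (x + t * \<phi> x - x) * (1 / \<phi> x)\<bar> \<le> (x + t * \<phi> x - x) * (d / \<phi> x)"
        using px by (intro F_bound near) auto
      then show ?thesis using px True by simp
    next
      case False
      then have "t * \<phi> x \<le> 0"
        using px by (simp add: mult_nonpos_nonneg)
      then have "\<bar>F x - F (x + t * \<phi> x) - (x - (x + t * \<phi> x)) * (1 / \<phi> x)\<bar> \<le> (x - (x + t * \<phi> x)) * (d / \<phi> x)"
        using False by (intro F_bound near) auto
      then show ?thesis using px False by (simp add: abs_minus_commute)
    qed
    then show ?case using d(2) by (simp add: dist_real_def)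
  qed
qed

text \<open>Continuity makes the power factor both measurable and Baire, so multiplying by it
  preserves whichever regularity is given.\<close>

lemma continuous_on_beurling_power: "continuous_on A (beurling_power \<phi> \<rho>)"
  unfolding beurling_power_def F_def[symmetric]
  by (intro continuous_intros continuous_at_imp_continuous_on ballI isCont_F)

lemma beurling_power_pos: "beurling_power \<phi> \<rho> x > 0"
  by (simp add: beurling_power_def)

lemma beurling_power_ratio_tendsto:
  "((\<lambda>x. beurling_power \<phi> \<rho> (x + t * \<phi> x) / beurling_power \<phi> \<rho> x) \<longlongrightarrow> exp (\<rho> * t)) at_top"
  unfolding beurling_power_def F_def[symmetric] exp_diff[symmetric] right_diff_distrib[symmetric]
  by (intro tendsto_intros F_shift_tendsto)

lemma measurable_beurling_power: "beurling_power \<phi> \<rho> \<in> borel_measurable lebesgue"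
  using borel_measurable_continuous_onI[OF continuous_on_beurling_power]
  by (simp add: measurable_completion)

lemma baire_beurling_power: "beurling_power \<phi> \<rho> \<in> borel_measurable baire_space"
  unfolding baire_property_iff_measurable[symmetric] baire_property_def
  using continuous_on_beurling_power
  by (auto intro!: baire_property_set_open open_vimage)

lemma beurling_rv_index_power_mult:
  assumes "beurling_slowly_varying \<phi> h"
  shows "beurling_rv_index \<phi> \<rho> (\<lambda>x. beurling_power \<phi> \<rho> x * h x)"
proof -
  have h: "\<And>x. h x > 0" "\<And>t. ((\<lambda>x. h (x + t * \<phi> x) / h x) \<longlongrightarrow> 1) at_top"
    and reg: "h \<in> borel_measurable baire_space \<or> h \<in> borel_measurable lebesgue"
    using assms
    by (auto simp: beurling_slowly_varying_def beurling_rv_limit_def baire_property_iff_measurable)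
  have "((\<lambda>x. (beurling_power \<phi> \<rho> (x + t * \<phi> x) * h (x + t * \<phi> x)) / (beurling_power \<phi> \<rho> x * h x))
      \<longlongrightarrow> exp (\<rho> * t)) at_top" for t
    using tendsto_mult[OF beurling_power_ratio_tendsto h(2)] by simp
  moreover have "(\<lambda>x. beurling_power \<phi> \<rho> x * h x) \<in> borel_measurable baire_space \<or>
      (\<lambda>x. beurling_power \<phi> \<rho> x * h x) \<in> borel_measurable lebesgue"
    using reg by (elim disj_forward)
      (auto intro: borel_measurable_times baire_beurling_power measurable_beurling_power)
  \<comment> \<open>An exponential is positive everywhere, so the set that must be non-negligible is
    the whole line.\<close>
  moreover have "\<not> meagre (UNIV :: real set)"
    by (rule open_not_meagre) auto
  ultimately show ?thesis
    unfolding beurling_rv_index_def beurling_rv_limit_def baire_property_iff_measurable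
    by (auto simp: h(1) beurling_power_pos null_sets_def)
qed

lemma beurling_slowly_varying_div_power:
  assumes f: "beurling_rv_limit \<phi> f (\<lambda>t. exp (\<rho> * t))" and meas: "f \<in> borel_measurable lebesgue"
  shows "beurling_slowly_varying \<phi> (\<lambda>x. f x / beurling_power \<phi> \<rho> x)"
proof -
  have pos: "f x > 0" for x
    using f by (simp add: beurling_rv_limit_def)
  have lim: "((\<lambda>x. f (x + t * \<phi> x) / f x) \<longlongrightarrow> exp (\<rho> * t)) at_top" for t
    using f by (simp add: beurling_rv_limit_def)
  have "((\<lambda>x. f (x + t * \<phi> x) / beurling_power \<phi> \<rho> (x + t * \<phi> x) / (f x / beurling_power \<phi> \<rho> x))
      \<longlongrightarrow> 1) at_top" for t
    using tendsto_divide[OF lim[of t] beurling_power_ratio_tendsto[where \<rho> = \<rho> and t = t]]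
    by (simp add: mult.commute)
  moreover have "(\<lambda>x. f x / beurling_power \<phi> \<rho> x) \<in> borel_measurable lebesgue"
    using meas measurable_beurling_power by (rule borel_measurable_divide)
  ultimately show ?thesis
    unfolding beurling_slowly_varying_def beurling_rv_limit_def
    by (auto simp: pos beurling_power_pos null_sets_def)
qed

end

subsection \<open>Smooth representation\<close>

text \<open>A step from 0 to 1 made of two parabolas, \<open>2 * u\<^sup>2\<close> on the first half
  of the unit interval and \<open>1 - 2 * (1 - u)\<^sup>2\<close> on the second. Truncated squares
  give one formula on the whole line; the derivative is a tent of height 2.\<close>

definition smooth_step :: "real \<Rightarrow> real" where
  "smooth_step u = 2 * (max 0 u)\<^sup>2 - 4 * (max 0 (u - 1/2))\<^sup>2 + 2 * (max 0 (u - 1))\<^sup>2"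

definition smooth_step' :: "real \<Rightarrow> real" where
  "smooth_step' u = 4 * max 0 u - 8 * max 0 (u - 1/2) + 4 * max 0 (u - 1)"

lemma has_real_derivative_max0_squared:
  "((\<lambda>u::real. (max 0 u)\<^sup>2) has_real_derivative 2 * max 0 u) (at u)"
proof -
  consider "u < 0" | "u = 0" | "u > 0" by linarith
  then show ?thesis
  proof cases
    case 1
    have "((\<lambda>u::real. 0) has_real_derivative 2 * max 0 u) (at u)"
      using 1 by simp
    then show ?thesis
      by (rule has_field_derivative_transform_within_open[of _ _ _ "{..<0}"]) (use 1 in auto)
  next
    case 3
    have "((\<lambda>u::real. u\<^sup>2) has_real_derivative 2 * max 0 u) (at u)"
      using 3 by (auto intro!: derivative_eq_intros)
    then show ?thesis
      by (rule has_field_derivative_transform_within_open[of _ _ _ "{0<..}"]) (use 3 in auto)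
  next
    case 2
    have "((\<lambda>h::real. max 0 h) \<longlongrightarrow> max 0 0) (at 0)"
      by (intro tendsto_intros)
    \<comment> \<open>At the origin the difference quotient is \<open>max 0 h\<close>
      itself.\<close>
    moreover have "\<forall>\<^sub>F h::real in at 0. max 0 h = ((max 0 (0 + h))\<^sup>2 - (max 0 0)\<^sup>2) / h"
      by (auto simp: eventually_at_filter power2_eq_square max_def)
    ultimately show ?thesis
      unfolding 2 DERIV_def by (auto intro: Lim_transform_eventually)
  qed
qed

lemma has_real_derivative_smooth_step:
  "(smooth_step has_real_derivative smooth_step' u) (at u)"
proof -
  have d: "((\<lambda>u::real. (max 0 (u - c))\<^sup>2) has_real_derivative 2 * max 0 (u - c)) (at u)" for c
  proof -
    have "((\<lambda>u. u - c) has_real_derivative 1) (at u)"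
      by (auto intro!: derivative_eq_intros)
    from DERIV_chain2[where g = "\<lambda>u. u - c", OF has_real_derivative_max0_squared this]
    show ?thesis by simp
  qed
  show ?thesis
    unfolding smooth_step_def[abs_def] smooth_step'_def
    by (rule derivative_eq_intros has_real_derivative_max0_squared d | simp)+
qed

lemma smooth_step_le_0: "u \<le> 0 \<Longrightarrow> smooth_step u = 0"
  by (simp add: smooth_step_def)

lemma smooth_step_ge_1: "u \<ge> 1 \<Longrightarrow> smooth_step u = 1"
  by (simp add: smooth_step_def power2_eq_square algebra_simps)

lemma smooth_step_range:
  assumes "0 \<le> u" "u \<le> 1"
  shows "0 \<le> smooth_step u" "smooth_step u \<le> 1"
proof -
  have "0 \<le> smooth_step u \<and> smooth_step u \<le> 1"
  proof (cases "u \<le> 1/2")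
    case True
    then have "u\<^sup>2 \<le> (1/2)\<^sup>2"
      using assms by (intro power_mono) auto
    then show ?thesis
      using True assms by (simp add: smooth_step_def power_divide)
  next
    case False
    then have "smooth_step u = 1 - 2 * (1 - u)\<^sup>2"
      using assms by (simp add: smooth_step_def power2_eq_square algebra_simps)
    moreover have "(1 - u)\<^sup>2 \<le> (1/2)\<^sup>2"
      using assms False by (intro power_mono) auto
    ultimately show ?thesis by (simp add: power_divide)
  qed
  then show "0 \<le> smooth_step u" "smooth_step u \<le> 1" by auto
qed

text \<open>The interpolant is a sum of steps with values \<open>k (n K)\<close> at the grid points; only finitely
  many steps matter on each half-line bounded above.\<close>

lemma C1_approximation:
  fixes k :: "real \<Rightarrow> real"
  assumes K: "K > 0"
    and osc: "\<And>e. e > 0 \<Longrightarrow> \<forall>\<^sub>F x in at_top. \<forall>y\<in>{x..x + K}. \<bar>k y - k x\<bar> < e"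
  obtains S where "S C1_differentiable_on UNIV" "((\<lambda>x. k x - S x) \<longlongrightarrow> 0) at_top"
proof
  define c where "c n = k (real n * K)" for n
  define S where "S x = c 0 + (\<Sum>n<nat \<lceil>x / K\<rceil>. (c (Suc n) - c n) * smooth_step (x / K - real n))" for x
  define D where "D x = (\<Sum>n<nat \<lceil>x / K\<rceil>. (c (Suc n) - c n) * (smooth_step' (x / K - real n) / K))" for x
  \<comment> \<open>On a half-line bounded above, the number of terms can be fixed at
    \<open>N\<close>, because the additional steps have not started. This makes termwise
    differentiation possible.\<close>
  have sum_extend: "(\<Sum>n<nat \<lceil>x / K\<rceil>. (c (Suc n) - c n) * F (x / K - real n)) =
      (\<Sum>n<N. (c (Suc n) - c n) * F (x / K - real n))"
    if "x \<le> real N * K" and F: "\<And>u. u \<le> 0 \<Longrightarrow> F u = 0" for x N and F :: "real \<Rightarrow> real"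
  proof (rule sum.mono_neutral_left)
    have "x / K \<le> real N" using that K by (simp add: field_simps)
    then show "{..<nat \<lceil>x / K\<rceil>} \<subseteq> {..<N}"
      by (auto simp: nat_le_iff ceiling_le_iff intro: less_le_trans)
    show "\<forall>n\<in>{..<N} - {..<nat \<lceil>x / K\<rceil>}. (c (Suc n) - c n) * F (x / K - real n) = 0"
    proof
      fix n assume "n \<in> {..<N} - {..<nat \<lceil>x / K\<rceil>}"
      then have "x / K - real n \<le> 0" by (auto simp: nat_le_iff ceiling_le_iff not_less)
      then show "(c (Suc n) - c n) * F (x / K - real n) = 0" by (simp add: F)
    qed
  qed simp
  have S_eq: "S x = c 0 + (\<Sum>n<N. (c (Suc n) - c n) * smooth_step (x / K - real n))"
    if "x \<le> real N * K" for x N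
    unfolding S_def using sum_extend[OF that, of smooth_step] by (simp add: smooth_step_le_0)
  have D_eq: "D x = (\<Sum>n<N. (c (Suc n) - c n) * (smooth_step' (x / K - real n) / K))"
    if "x \<le> real N * K" for x N
    unfolding D_def using sum_extend[OF that, of "\<lambda>u. smooth_step' u / K"] by (simp add: smooth_step'_def)
  have grid: "\<exists>N. x < real N * K" for x
    using reals_Archimedean2[of "x / K"] K by (simp add: field_simps)
  show "S C1_differentiable_on UNIV"
    unfolding C1_differentiable_on_def
  proof (intro exI[of _ D] conjI ballI)
    fix x
    obtain N where N: "x < real N * K" using grid by blast
    have chain: "((\<lambda>x. smooth_step (x / K - real n)) has_real_derivative smooth_step' (x / K - real n) / K) (at x)" for n
    proof -
      have "((\<lambda>x. x / K - real n) has_real_derivative 1 / K) (at x)"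
        using K by (auto intro!: derivative_eq_intros)
      from DERIV_chain2[where g = "\<lambda>x. x / K - real n", OF has_real_derivative_smooth_step this]
      show ?thesis by simp
    qed
    have "((\<lambda>x. c 0 + (\<Sum>n<N. (c (Suc n) - c n) * smooth_step (x / K - real n))) has_real_derivative D x) (at x)"
      using N by (auto simp: D_eq[of x N] mult.commute intro!: derivative_eq_intros chain)
    then have "(S has_real_derivative D x) (at x)"
      by (rule has_field_derivative_transform_within_open[of _ _ _ "{..<real N * K}"])
        (use N in \<open>auto simp: S_eq[of _ N]\<close>)
    then show "(S has_vector_derivative D x) (at x)"
      by (simp add: has_real_derivative_iff_has_vector_derivative)
  next
    have "isCont D x" for x
    proof -
      obtain N where N: "x < real N * K" using grid by blast
      have "continuous_on {..<real N * K} (\<lambda>x. \<Sum>n<N. (c (Suc n) - c n) * (smooth_step' (x / K - real n) / K))"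
        unfolding smooth_step'_def using K by (intro continuous_intros) auto
      then have "continuous_on {..<real N * K} D"
        by (rule continuous_on_eq) (simp add: D_eq[of _ N])
      then show ?thesis
        using N by (simp add: continuous_on_eq_continuous_at)
    qed
    then show "continuous_on UNIV D" by (simp add: continuous_at_imp_continuous_on)
  qed
  show "((\<lambda>x. k x - S x) \<longlongrightarrow> 0) at_top"
  proof (rule tendstoI)
    fix e :: real assume "e > 0"
    then obtain X where X: "\<And>x y. x \<ge> X \<Longrightarrow> y \<in> {x..x + K} \<Longrightarrow> \<bar>k y - k x\<bar> < e / 2"
      using osc[of "e / 2"] unfolding eventually_at_top_linorder by (meson half_gt_zero)
    \<comment> \<open>The grid point below \<open>x\<close> is less than \<open>K\<close> away, so
      it is still at least \<open>X\<close>; nonnegativity of \<open>x\<close> keeps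
      \<open>nat\<close> from truncating the floor.\<close>
    have "\<forall>\<^sub>F x in at_top. x \<ge> max 0 X + K" by (rule eventually_ge_at_top)
    then show "\<forall>\<^sub>F x in at_top. dist (k x - S x) 0 < e"
    proof eventually_elim
      case (elim x)
      define n where "n = nat \<lfloor>x / K\<rfloor>"
      have "x / K \<ge> 0" using elim K by simp
      then have "real n \<le> x / K" "x / K < real n + 1" by (auto simp: n_def)
      then have n: "real n * K \<le> x" "x \<le> real (Suc n) * K" "0 \<le> x / K - real n" "x / K - real n \<le> 1"
        using K by (auto simp: field_simps)
      then have nX: "real n * K \<ge> X"
        using elim by (simp add: algebra_simps)
      \<comment> \<open>All earlier steps are complete, so their sum telescopes and
        \<open>S x\<close> lies between the two neighbouring grid values.\<close>
      have "(\<Sum>m<n. (c (Suc m) - c m) * smooth_step (x / K - real m)) = (\<Sum>m<n. c (Suc m) - c m)"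
      proof (intro sum.cong refl)
        fix m assume "m \<in> {..<n}"
        then have "real m + 1 \<le> real n" by auto
        then show "(c (Suc m) - c m) * smooth_step (x / K - real m) = c (Suc m) - c m"
          using n by (simp add: smooth_step_ge_1)
      qed
      then have "S x = c n + (c (Suc n) - c n) * smooth_step (x / K - real n)"
        using S_eq[OF n(2)] by (simp add: sum_lessThan_telescope)
      then have "\<bar>S x - c n\<bar> \<le> \<bar>c (Suc n) - c n\<bar>"
        using smooth_step_range[OF n(3,4)] by (simp add: abs_mult mult_left_le)
      moreover have "\<bar>c (Suc n) - c n\<bar> < e / 2"
        unfolding c_def using nX K by (intro X) (auto simp: algebra_simps)
      moreover have "\<bar>k x - c n\<bar> < e / 2"
        unfolding c_def using nX n by (intro X) (auto simp: algebra_simps)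
      ultimately have "\<bar>k x - S x\<bar> < e" by linarith
      then show ?case by (simp add: dist_real_def)
    qed
  qed
qed

lemma beurling_slowly_varying_smooth_representation:
  assumes sn: "self_neglecting \<phi>" and h: "beurling_slowly_varying \<phi> h"
    and K: "K > 0" "\<And>x. x \<ge> X \<Longrightarrow> \<phi> x \<ge> K"
  obtains \<psi> where "smooth_representation h \<psi>"
proof -
  have rv: "beurling_rv_limit \<phi> h (\<lambda>t. 1)"
    using h by (simp add: beurling_slowly_varying_def)
  then have pos: "h x > 0" for x
    by (simp add: beurling_rv_limit_def)
  have h_nz: "h x \<noteq> 0" for x
    using pos[of x] by simp
  \<comment> \<open>Once \<open>\<phi> x \<ge> K\<close>, each \<open>y\<close> in
    \<open>{x..x + K}\<close> is \<open>x + t * \<phi> x\<close> with \<open>t\<close> in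
    \<open>{0..1}\<close>, where the ratio tends to 1 uniformly.\<close>
  have osc: "\<forall>\<^sub>F x in at_top. \<forall>y\<in>{x..x + K}. \<bar>ln (h y) - ln (h x)\<bar> < e" if e: "e > 0" for e
  proof -
    have "isCont ln (1::real)" by (rule isCont_ln) simp
    then obtain d where d: "d > 0" "\<And>r::real. \<bar>r - 1\<bar> < d \<Longrightarrow> \<bar>ln r\<bar> < e"
      using e unfolding continuous_at_eps_delta by (auto simp: dist_real_def)
    have "\<forall>\<^sub>F x in at_top. \<forall>t\<in>{0..1}. \<bar>h (x + t * \<phi> x) / h x - 1\<bar> < d"
      using beurling_rv_limit_uniform[OF sn rv d(1), of "{0..1}"] by simp
    then show ?thesis
      using eventually_ge_at_top[of X]
    proof eventually_elim
      case (elim x)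
      show ?case
      proof
        fix y assume y: "y \<in> {x..x + K}"
        have px: "\<phi> x > 0" using sn by (rule self_neglecting_pos)
        have "(y - x) / \<phi> x \<in> {0..1}"
          using y px K(2)[OF elim(2)] by (auto simp: field_simps)
        then have "\<bar>h (x + (y - x) / \<phi> x * \<phi> x) / h x - 1\<bar> < d"
          using elim(1) by blast
        then have "\<bar>h y / h x - 1\<bar> < d" using px by simp
        then have "\<bar>ln (h y / h x)\<bar> < e" by (rule d(2))
        then show "\<bar>ln (h y) - ln (h x)\<bar> < e" by (simp add: ln_div h_nz)
      qed
    qed
  qed
  obtain S where S: "S C1_differentiable_on UNIV" "((\<lambda>x. ln (h x) - S x) \<longlongrightarrow> 0) at_top"
    using C1_approximation[OF K(1), of "\<lambda>x. ln (h x)"] osc by blast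
  show ?thesis
  proof
    obtain D where D: "\<And>x. (S has_vector_derivative D x) (at x)" "continuous_on UNIV D"
      using S(1) by (auto simp: C1_differentiable_on_def)
    have "((\<lambda>x. exp (S x)) has_vector_derivative exp (S x) * D x) (at x)" for x
      using D(1)[of x] unfolding has_real_derivative_iff_has_vector_derivative[symmetric]
      by (auto intro!: derivative_eq_intros)
    moreover have "continuous_on UNIV (\<lambda>x. exp (S x) * D x)"
      by (intro continuous_intros D(2) C1_differentiable_imp_continuous_on S(1))
    ultimately have C1: "(\<lambda>x. exp (S x)) C1_differentiable_on UNIV"
      unfolding C1_differentiable_on_def by (intro exI[of _ "\<lambda>x. exp (S x) * D x"]) simp
    have "((\<lambda>x. exp (ln (h x) - S x)) \<longlongrightarrow> exp 0) at_top"
      by (intro tendsto_exp S(2))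
    then have "h \<sim>[at_top] (\<lambda>x. exp (S x))"
      by (intro asymp_equivI') (simp add: exp_diff pos)
    with C1 show "smooth_representation h (\<lambda>x. exp (S x))"
      by (simp add: smooth_representation_def)
  qed
qed

theorem theorem6:
  fixes \<phi> f :: "real \<Rightarrow> real"
  assumes "self_neglecting \<phi>"
    and "baire_property \<phi> \<or> \<phi> \<in> borel_measurable lebesgue"
    and "\<exists>K>0. \<exists>X. \<forall>x\<ge>X. \<phi> x \<ge> K"
    and "\<And>a b. (\<lambda>u. 1 / \<phi> u) absolutely_integrable_on {a..b}"
    and "f \<in> borel_measurable lebesgue"
    and "beurling_regularly_varying \<phi> f"
  shows "(\<exists>\<rho> h. beurling_slowly_varying \<phi> h \<and>
            (\<forall>x. f x = beurling_power \<phi> \<rho> x * h x) \<and>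
            (\<exists>\<psi>. smooth_representation h \<psi> \<and>
                 f \<sim>[at_top] (\<lambda>x. beurling_power \<phi> \<rho> x * \<psi> x)))
       \<and> (\<forall>\<rho> h. beurling_slowly_varying \<phi> h \<longrightarrow>
            beurling_rv_index \<phi> \<rho> (\<lambda>x. beurling_power \<phi> \<rho> x * h x))"
proof (intro conjI allI impI)
  note sn = assms(1) and int = assms(4)
  show "beurling_rv_index \<phi> \<rho> (\<lambda>x. beurling_power \<phi> \<rho> x * h x)"
    if "beurling_slowly_varying \<phi> h" for \<rho> h
    using sn int that by (rule beurling_rv_index_power_mult)
  obtain K X where K: "K > 0" "\<And>x. x \<ge> X \<Longrightarrow> \<phi> x \<ge> K"
    using assms(3) by blast
  obtain g where g: "beurling_rv_limit \<phi> f g"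
    using assms(6) by (auto simp: beurling_regularly_varying_def)
  obtain \<rho> where \<rho>: "g = (\<lambda>t. exp (\<rho> * t))"
    using sn g by (rule beurling_rv_limit_exp)
  define h where "h x = f x / beurling_power \<phi> \<rho> x" for x
  have slow: "beurling_slowly_varying \<phi> h"
    unfolding h_def using sn int g[unfolded \<rho>] assms(5) by (rule beurling_slowly_varying_div_power)
  have f_eq: "f x = beurling_power \<phi> \<rho> x * h x" for x
    by (simp add: h_def beurling_power_def)
  obtain \<psi> where \<psi>: "smooth_representation h \<psi>"
    using sn slow K by (rule beurling_slowly_varying_smooth_representation)
  have "f \<sim>[at_top] (\<lambda>x. beurling_power \<phi> \<rho> x * \<psi> x)"
    unfolding f_eq[abs_def] using \<psi>
    by (intro asymp_equiv_mult asymp_equiv_refl) (simp add: smooth_representation_def)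
  with slow f_eq \<psi> show "\<exists>\<rho> h. beurling_slowly_varying \<phi> h \<and>
      (\<forall>x. f x = beurling_power \<phi> \<rho> x * h x) \<and>
      (\<exists>\<psi>. smooth_representation h \<psi> \<and> f \<sim>[at_top] (\<lambda>x. beurling_power \<phi> \<rho> x * \<psi> x))"
    by blast
qed

end
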